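(* Let $U$ be a Banach Lie group and $G\le U$ a compact subgroup. For sufficiently small neighborhoods $V\supseteq G$ in $U$, all finite subgroups $F\le U$ contained in $V$ have abelian normal subgroups whose indices in $F$ are bounded uniformly by a constant depending only on the embedding $G\le U$. (That is: there are a positive integer $N$ and a neighborhood $V_0$ of $G$ such that every finite subgroup $F\le U$ contained in $V_0$ has an abelian normal subgroup of index $\le N$.)
   Context: A Banach Lie group is an analytic real Lie group modeled on a (possibly infinite-dimensional) Banach space. *)

theory Defs
  imports "HOL-Analysis.Analysis" "HOL-Algebra.Coset"
begin

text \<open>
  Bounded \<open>k\<close>-linear maps. The \<open>k\<close> arguments are the values of \<open>v\<close> at \<open>0, \<dots>, k - 1\<close>; the first
  conjunct says that the other values of \<open>v\<close> are irrelevant, and \<open>c\<close> bounds the operator norm.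
\<close>

definition bounded_multilinear_by ::
    "nat \<Rightarrow> ((nat \<Rightarrow> 'a::real_normed_vector) \<Rightarrow> 'b::real_normed_vector) \<Rightarrow> real \<Rightarrow> bool"
  where "bounded_multilinear_by k m c \<longleftrightarrow>
    (\<forall>v w. (\<forall>i<k. v i = w i) \<longrightarrow> m v = m w) \<and>
    (\<forall>i<k. \<forall>v. linear (\<lambda>x. m (v(i := x)))) \<and>
    (\<forall>v. norm (m v) \<le> c * (\<Prod>i<k. norm (v i)))"

text \<open>
  Real analyticity on an open set (openness of \<open>S\<close> is forced by the inclusion of balls): around each
  point \<open>f\<close> is the sum of a power series \<open>\<Sum>k. m k (h, \<dots>, h)\<close> of bounded homogeneous
  polynomials with \<open>\<Sum>k. \<parallel>m k\<parallel> * r ^ k < \<infinity>\<close>.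
\<close>

definition real_analytic_on ::
    "('a::real_normed_vector \<Rightarrow> 'b::real_normed_vector) \<Rightarrow> 'a set \<Rightarrow> bool"
  where "real_analytic_on f S \<longleftrightarrow>
    (\<forall>x\<in>S. \<exists>r>0. ball x r \<subseteq> S \<and>
      (\<exists>m c. (\<forall>k. bounded_multilinear_by k (m k) (c k)) \<and>
             summable (\<lambda>k. c k * r ^ k) \<and>
             (\<forall>h. norm h < r \<longrightarrow> (\<lambda>k. m k (\<lambda>_. h)) sums f (x + h))))"

text \<open>
  A chart is a pair of its domain \<open>D\<close> and a map \<open>\<phi>\<close>, of which only the values on \<open>D\<close> matter.
\<close>

type_synonym ('a, 'e) chart = "'a set \<times> ('a \<Rightarrow> 'e)"

definition is_chart :: "'a topology \<Rightarrow> ('a, 'e::real_normed_vector) chart \<Rightarrow> bool"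
  where "is_chart T = (\<lambda>(D, \<phi>). openin T D \<and> open (\<phi> ` D) \<and>
    homeomorphic_map (subtopology T D) (top_of_set (\<phi> ` D)) \<phi>)"

definition analytic_atlas :: "'a topology \<Rightarrow> ('a, 'e::real_normed_vector) chart set \<Rightarrow> bool"
  where "analytic_atlas T \<A> \<longleftrightarrow>
    (\<forall>C\<in>\<A>. is_chart T C) \<and>
    (\<Union>(D, \<phi>)\<in>\<A>. D) = topspace T \<and>
    (\<forall>(D, \<phi>)\<in>\<A>. \<forall>(E, \<psi>)\<in>\<A>. real_analytic_on (\<psi> \<circ> inv_into D \<phi>) (\<phi> ` (D \<inter> E)))"

definition prod_atlas ::
    "('a, 'e) chart set \<Rightarrow> ('b, 'f) chart set \<Rightarrow> ('a \<times> 'b, 'e \<times> 'f) chart set"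
  where "prod_atlas \<A> \<B> = {(D \<times> E, map_prod \<phi> \<psi>) | D \<phi> E \<psi>. (D, \<phi>) \<in> \<A> \<and> (E, \<psi>) \<in> \<B>}"

definition analytic_map ::
    "'a topology \<Rightarrow> ('a, 'e::real_normed_vector) chart set \<Rightarrow>
     'b topology \<Rightarrow> ('b, 'f::real_normed_vector) chart set \<Rightarrow> ('a \<Rightarrow> 'b) \<Rightarrow> bool"
  where "analytic_map S \<A> T \<B> f \<longleftrightarrow>
    continuous_map S T f \<and>
    (\<forall>(D, \<phi>)\<in>\<A>. \<forall>(E, \<psi>)\<in>\<B>.
      real_analytic_on (\<psi> \<circ> f \<circ> inv_into D \<phi>) (\<phi> ` {x \<in> D. f x \<in> E}))"

locale banach_lie_group = group U
  for U (structure) +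
  fixes T :: "'u topology" and \<A> :: "('u, 'e::banach) chart set"
  assumes topspace_eq: "topspace T = carrier U"
    and Hausdorff: "Hausdorff_space T"
    and atlas: "analytic_atlas T \<A>"
    and mult_analytic:
      "analytic_map (prod_topology T T) (prod_atlas \<A> \<A>) T \<A> (\<lambda>(x, y). x \<otimes> y)"
    and inv_analytic: "analytic_map T \<A> T \<A> (\<lambda>x. inv x)"

end

theory Submission
  imports Defs "HOL-Algebra.Generated_Groups"
begin

text \<open>
  The proof is Frobenius's argument for Jordan's theorem on finite linear groups, with the
  eigenvalue computation replaced by the absence of small subgroups.

  Let \<open>\<psi>\<close> be a chart at the identity with \<open>\<psi> 1 = 0\<close>. Because multiplication is analytic and
  \<open>x 1 = x = 1 x\<close>, the terms of its power series that involve only one factor are known, and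
  \<open>\<parallel>\<psi>(x y) - \<psi> x - \<psi> y\<parallel> \<le> C \<parallel>\<psi> x\<parallel> \<parallel>\<psi> y\<parallel>\<close> near the identity
  (\<open>real_analytic_second_difference\<close>, \<open>group_chart_exists\<close>). This estimate is all that is used of
  the analytic structure. It has two consequences on a small ball \<open>B\<close>: squaring expands norms
  by \<open>3/2\<close>, so that an element whose powers all stay in \<open>B\<close> is trivial (\<open>no_small_powers\<close>); and
  \<open>\<parallel>\<psi>[x, y]\<parallel> \<le> \<parallel>\<psi> y\<parallel> / 2\<close> (\<open>commutator_contracts\<close>).

  By compactness of \<open>G\<close> there are a neighbourhood \<open>V\<close> of \<open>G\<close> and a ball \<open>B' \<subseteq> B\<close> such that
  \<open>[x, y] \<in> B\<close> whenever \<open>x \<in> V\<close> and \<open>y \<in> B'\<close>. Let \<open>F \<subseteq> V\<close> be a finite subgroup. Then the elements of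
  \<open>F \<inter> B'\<close> commute (\<open>near_elements_commute\<close>): otherwise choose \<open>x, y\<close> in it which do not commute,
  with \<open>\<parallel>\<psi> y\<parallel>\<close> minimal for this \<open>x\<close>. The commutator \<open>c = [x, y]\<close> is shorter than \<open>y\<close>, so it
  commutes with \<open>x\<close>; hence \<open>c\<^sup>m = [x\<^sup>m, y]\<close>, and this lies in \<open>B\<close> for every \<open>m\<close> because
  \<open>x\<^sup>m \<in> F \<subseteq> V\<close>. So \<open>c\<close> is trivial, a contradiction.

  Finally, the elements of \<open>F\<close> all of whose \<open>F\<close>-conjugates lie in \<open>B'\<close> generate an abelian normal
  subgroup of \<open>F\<close>. After shrinking \<open>V\<close> they include all of \<open>F\<close> in a fixed smaller ball, and \<open>V\<close> is
  covered by finitely many right translates of a neighbourhood whose right quotients \<open>x y\<inverse>\<close> lie in that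
  ball. The number of translates bounds the index.
\<close>

section \<open>Second differences of analytic maps\<close>

text \<open>
  Multilinear maps are evaluated on functions defined on all of \<open>nat\<close>, so the expansion is proved
  one slot at a time, with arbitrary vectors \<open>v\<close> in the slots that are still to come.
\<close>

lemma multilinear_expand:
  assumes m: "bounded_multilinear_by k m c" and "n \<le> k"
  shows "m (\<lambda>i. if i < n then a + b else v i) =
    (\<Sum>S\<in>Pow {..<n}. m (\<lambda>i. if i < n then (if i \<in> S then a else b) else v i))"
  using \<open>n \<le> k\<close>
proof (induction n arbitrary: v)
  case 0
  then show ?case by simp
next
  case (Suc n)
  define w where "w S = (\<lambda>i. if i < n then (if i \<in> S then a else b) else v i)" for S
  have split: "m ((w S)(n := a + b)) = m ((w S)(n := a)) + m ((w S)(n := b))" for S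
    using m Suc.prems unfolding bounded_multilinear_by_def
    by (metis (no_types, lifting) Suc_le_eq linear_add)
  have "(\<lambda>i. if i < Suc n then a + b else v i) = (\<lambda>i. if i < n then a + b else (v(n := a + b)) i)"
    by (auto simp: fun_eq_iff)
  then have "m (\<lambda>i. if i < Suc n then a + b else v i) =
      (\<Sum>S\<in>Pow {..<n}. m (\<lambda>i. if i < n then (if i \<in> S then a else b) else (v(n := a + b)) i))"
    using Suc.IH[of "v(n := a + b)"] Suc.prems by simp
  also have "\<dots> = (\<Sum>S\<in>Pow {..<n}. m ((w S)(n := a + b)))"
    by (intro sum.cong refl arg_cong[of _ _ m]) (auto simp: w_def fun_eq_iff)
  also have "\<dots> = (\<Sum>S\<in>Pow {..<n}. m ((w S)(n := b))) + (\<Sum>S\<in>Pow {..<n}. m ((w S)(n := a)))"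
    by (simp add: split sum.distrib)
  also have "(\<Sum>S\<in>Pow {..<n}. m ((w S)(n := b))) =
      (\<Sum>S\<in>Pow {..<n}. m (\<lambda>i. if i < Suc n then (if i \<in> S then a else b) else v i))"
    by (intro sum.cong refl arg_cong[of _ _ m]) (auto simp: w_def fun_eq_iff)
  also have "(\<Sum>S\<in>Pow {..<n}. m ((w S)(n := a))) =
      (\<Sum>S\<in>insert n ` Pow {..<n}. m (\<lambda>i. if i < Suc n then (if i \<in> S then a else b) else v i))"
    by (subst sum.reindex)
      (auto simp: w_def fun_eq_iff inj_on_def intro!: sum.cong arg_cong[of _ _ m])
  finally show ?case
    unfolding lessThan_Suc Pow_insert by (subst sum.union_disjoint) auto
qed

lemma multilinear_binomial:
  assumes m: "bounded_multilinear_by k m c"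
  shows "m (\<lambda>_. a + b) = (\<Sum>S\<in>Pow {..<k}. m (\<lambda>i. if i \<in> S then a else b))"
proof -
  have irrel: "m v = m w" if "\<And>i. i < k \<Longrightarrow> v i = w i" for v w
    using m that unfolding bounded_multilinear_by_def by blast
  have "m (\<lambda>_. a + b) = m (\<lambda>i. if i < k then a + b else 0)"
    by (rule irrel) simp
  also have "\<dots> = (\<Sum>S\<in>Pow {..<k}. m (\<lambda>i. if i < k then (if i \<in> S then a else b) else 0))"
    using multilinear_expand[OF m order_refl] .
  also have "\<dots> = (\<Sum>S\<in>Pow {..<k}. m (\<lambda>i. if i \<in> S then a else b))"
    by (intro sum.cong refl irrel) simp
  finally show ?thesis .
qed

text \<open>
  A subset that is neither empty nor full puts both vectors to use, which yields the factor
  \<open>\<parallel>a\<parallel> \<parallel>b\<parallel>\<close>; the other \<open>k - 2\<close> factors are estimated by \<open>s\<close>.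
\<close>

lemma mixed_product_le:
  fixes a b :: "'a::real_normed_vector"
  assumes S: "S \<subseteq> {..<k}" "S \<noteq> {}" "S \<noteq> {..<k}"
    and ab: "norm a \<le> s" "norm b \<le> s" and s: "s > 0"
  shows "(\<Prod>i<k. norm (if i \<in> S then a else b)) \<le> s ^ k / s\<^sup>2 * (norm a * norm b)"
proof -
  let ?g = "\<lambda>i. norm (if i \<in> S then a else b)"
  obtain p q where pq: "p \<in> S" "p < k" "q \<notin> S" "q < k"
    using S by blast
  let ?R = "{..<k} - {p} - {q}"
  have card: "card ?R = k - 2"
    using pq by (auto simp: card_Diff_singleton_if)
  have "p \<noteq> q" using pq by blast
  then have k: "k = card ?R + 2"
    using pq(2,4) card by linarith
  have "(\<Prod>i<k. ?g i) = ?g p * (?g q * (\<Prod>i\<in>?R. ?g i))"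
    using pq by (subst prod.remove[of _ p], simp_all, subst prod.remove[of _ q], auto)
  also have "\<dots> = norm a * norm b * (\<Prod>i\<in>?R. ?g i)"
    using pq by simp
  also have "\<dots> \<le> norm a * norm b * (\<Prod>i\<in>?R. s)"
    using ab by (intro mult_left_mono prod_mono) auto
  also have "(\<Prod>i\<in>?R. s) = s ^ k / s\<^sup>2"
    using s k by (simp add: field_simps flip: power_add)
  finally show ?thesis
    by (simp add: mult_ac)
qed

text \<open>
  In the expansion of \<open>m (a + b, \<dots>, a + b)\<close> the pure terms cancel, and there are at most \<open>2 ^ k\<close> mixed
  ones. The summand \<open>m (0, \<dots>, 0)\<close> vanishes for \<open>k > 0\<close>; it makes the estimate true for \<open>k = 0\<close> as well.
\<close>

lemma multilinear_second_difference:
  fixes a b :: "'a::real_normed_vector"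
  assumes m: "bounded_multilinear_by k m c" and c: "c \<ge> 0"
    and ab: "norm a \<le> s" "norm b \<le> s" and s: "s > 0"
  shows "norm (m (\<lambda>_. a + b) - m (\<lambda>_. a) - m (\<lambda>_. b) + m (\<lambda>_. 0))
    \<le> c * (2 * s) ^ k * (norm a * norm b / s\<^sup>2)"
proof -
  have irrel: "m v = m w" if "\<And>i. i < k \<Longrightarrow> v i = w i" for v w
    using m that unfolding bounded_multilinear_by_def by blast
  have bound: "norm (m v) \<le> c * (\<Prod>i<k. norm (v i))" for v
    using m unfolding bounded_multilinear_by_def by blast
  show ?thesis
  proof (cases "k = 0")
    case True
    then have "m v = m (\<lambda>_. 0)" for v
      by (intro irrel) simp
    then have "norm (m (\<lambda>_. a + b) - m (\<lambda>_. a) - m (\<lambda>_. b) + m (\<lambda>_. 0)) = 0"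
      by (metis add.commute add_0 diff_add_cancel diff_self norm_zero)
    then show ?thesis using c s by simp
  next
    case False
    let ?M = "Pow {..<k} - {{}} - {{..<k}}"
    let ?t = "\<lambda>S. m (\<lambda>i. if i \<in> S then a else b)"
    have m0: "m (\<lambda>_. 0) = 0"
      using bound[of "\<lambda>_. 0"] False by (simp add: power_0_left)
    have ne: "{..<k} \<noteq> {}" using False by auto
    have "m (\<lambda>_. a + b) = ?t {} + (?t {..<k} + (\<Sum>S\<in>?M. ?t S))"
      unfolding multilinear_binomial[OF m]
      using ne by (subst sum.remove[of _ "{}"], simp_all, subst sum.remove[of _ "{..<k}"], auto)
    moreover have "?t {..<k} = m (\<lambda>_. a)"
      by (rule irrel) simp
    ultimately have "m (\<lambda>_. a + b) - m (\<lambda>_. a) - m (\<lambda>_. b) + m (\<lambda>_. 0) = (\<Sum>S\<in>?M. ?t S)"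
      using m0 by simp
    also have "norm \<dots> \<le> of_nat (card ?M) * (c * (s ^ k / s\<^sup>2 * (norm a * norm b)))"
    proof (rule sum_norm_bound)
      fix S assume "S \<in> ?M"
      then have "(\<Prod>i<k. norm (if i \<in> S then a else b)) \<le> s ^ k / s\<^sup>2 * (norm a * norm b)"
        by (intro mixed_product_le ab s) auto
      then show "norm (?t S) \<le> c * (s ^ k / s\<^sup>2 * (norm a * norm b))"
        using bound[of "\<lambda>i. if i \<in> S then a else b"] c by (meson mult_left_mono order_trans)
    qed
    also have "\<dots> \<le> 2 ^ k * (c * (s ^ k / s\<^sup>2 * (norm a * norm b)))"
    proof (rule mult_right_mono)
      have "card ?M \<le> card (Pow {..<k})"
        by (intro card_mono) auto
      then have "card ?M \<le> 2 ^ k"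
        by (simp add: card_Pow)
      then show "real (card ?M) \<le> 2 ^ k"
        by (metis of_nat_le_iff of_nat_numeral of_nat_power)
    qed (use c s in simp)
    finally show ?thesis
      by (simp add: power_mult_distrib mult_ac)
  qed
qed

text \<open>
  The factor \<open>2 ^ k\<close> from the previous estimate is absorbed by passing to half the radius on which the
  power series converges absolutely.
\<close>

lemma real_analytic_second_difference:
  fixes f :: "'a::real_normed_vector \<Rightarrow> 'b::banach"
  assumes f: "real_analytic_on f S" and x: "x \<in> S"
  obtains r C where "r > 0" "C > 0" "ball x r \<subseteq> S"
    "\<And>a b. \<lbrakk>norm a < r; norm b < r\<rbrakk> \<Longrightarrow>
      norm (f (x + (a + b)) - f (x + a) - f (x + b) + f x) \<le> C * (norm a * norm b)"
proof -
  obtain r m c where r: "r > 0" "ball x r \<subseteq> S"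
    and m: "\<And>k. bounded_multilinear_by k (m k) (c k)"
    and c: "summable (\<lambda>k. c k * r ^ k)"
    and sums: "\<And>h. norm h < r \<Longrightarrow> (\<lambda>k. m k (\<lambda>_. h)) sums f (x + h)"
    using bspec[OF f[unfolded real_analytic_on_def] x] by auto
  define s where "s = r / 2"
  define C where "C = max 1 ((\<Sum>k. c k * r ^ k) / s\<^sup>2)"
  have s: "s > 0" using r by (simp add: s_def)
  have "norm (f (x + (a + b)) - f (x + a) - f (x + b) + f x) \<le> C * (norm a * norm b)"
    if a: "norm a < s" and b: "norm b < s" for a b
  proof (cases "a = 0")
    case False
    \<comment> \<open>The bounds \<open>c k\<close> could be negative if \<open>0\<close> were the only vector; here \<open>a \<noteq> 0\<close>.\<close>
    have cpos: "c k \<ge> 0" for k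
    proof -
      have "0 \<le> norm (m k (\<lambda>_. a))" by simp
      also have "\<dots> \<le> c k * (\<Prod>i<k. norm a)"
        using m[of k] unfolding bounded_multilinear_by_def by blast
      finally show ?thesis
        using False by (simp add: zero_le_mult_iff power_le_zero_eq)
    qed
    have nab: "norm (a + b) < r"
      using norm_triangle_ineq[of a b] a b by (simp add: s_def)
    let ?d = "\<lambda>k. m k (\<lambda>_. a + b) - m k (\<lambda>_. a) - m k (\<lambda>_. b) + m k (\<lambda>_. 0)"
    have d: "?d sums (f (x + (a + b)) - f (x + a) - f (x + b) + f (x + 0))"
      using a b r by (intro sums_add sums_diff sums nab) (auto simp: s_def)
    have le: "norm (?d k) \<le> c k * r ^ k * (norm a * norm b / s\<^sup>2)" for k
      using multilinear_second_difference[OF m cpos _ _ s, of a b k] a b by (simp add: s_def)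
    have sum: "summable (\<lambda>k. c k * r ^ k * (norm a * norm b / s\<^sup>2))"
      using c by (rule summable_mult2)
    have "norm (f (x + (a + b)) - f (x + a) - f (x + b) + f x) \<le>
        (\<Sum>k. c k * r ^ k * (norm a * norm b / s\<^sup>2))"
      using norm_sums_le[OF d summable_sums[OF sum] le] by simp
    also have "\<dots> = (\<Sum>k. c k * r ^ k) / s\<^sup>2 * (norm a * norm b)"
      by (subst suminf_mult2[OF c, symmetric]) simp
    also have "\<dots> \<le> C * (norm a * norm b)"
      unfolding C_def by (intro mult_right_mono) auto
    finally show ?thesis .
  qed simp
  moreover have "ball x s \<subseteq> S"
    using r by (auto simp: s_def)
  moreover have "C > 0"
    by (simp add: C_def less_max_iff_disj)
  ultimately show ?thesis
    using s by (intro that[of s C])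
qed

section \<open>Commutators, commuting generators and indices\<close>

abbreviation (in monoid) commutator
  where "commutator x y \<equiv> x \<otimes> y \<otimes> inv x \<otimes> inv y"

lemma (in group) commutator_mult:
  assumes "x \<in> carrier G" "y \<in> carrier G"
  shows "commutator x y \<otimes> (y \<otimes> x) = x \<otimes> y"
  using assms by (simp add: m_assoc inv_solve_left')

lemma (in group) commutator_eq_one_iff:
  assumes "x \<in> carrier G" "y \<in> carrier G"
  shows "commutator x y = \<one> \<longleftrightarrow> x \<otimes> y = y \<otimes> x"
  using assms by (metis commutator_mult inv_closed l_one m_closed r_cancel_one')

text \<open>
  If \<open>c = [x, y]\<close> commutes with \<open>x\<close>, then conjugation by \<open>y\<close> maps \<open>x\<close> to \<open>c\<inverse> x\<close>, a product of commuting
  elements, and therefore \<open>x\<^sup>m\<close> to \<open>c\<^sup>-\<^sup>m x\<^sup>m\<close>.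
\<close>

lemma (in group) commutator_pow_left:
  assumes x: "x \<in> carrier G" and y: "y \<in> carrier G"
    and comm: "x \<otimes> commutator x y = commutator x y \<otimes> x"
  shows "commutator (x [^] m) y = commutator x y [^] (m :: nat)"
proof (induction m)
  case 0
  then show ?case using y by simp
next
  case (Suc m)
  define c where "c = commutator x y"
  define a where "a = x [^] m"
  have cl: "c \<in> carrier G" "a \<in> carrier G"
    using x y by (auto simp: c_def a_def)
  have xy: "x \<otimes> (y \<otimes> inv x) = c \<otimes> y"
    using x y by (simp add: c_def m_assoc)
  have "c \<otimes> a = a \<otimes> c"
    unfolding a_def using x cl comm by (metis c_def pow_mult_distrib group_commutes_pow)
  have "commutator (x [^] Suc m) y = a \<otimes> (x \<otimes> (y \<otimes> inv x)) \<otimes> inv a \<otimes> inv y"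
    using x y cl by (simp add: a_def[symmetric] inv_mult_group m_assoc)
  also have "\<dots> = c \<otimes> commutator a y"
    unfolding xy using x y cl \<open>c \<otimes> a = a \<otimes> c\<close> by (metis inv_closed m_assoc m_closed)
  also have "\<dots> = c [^] Suc m"
    using Suc.IH cl unfolding a_def[symmetric] c_def[symmetric] by (metis nat_pow_Suc2)
  finally show ?case unfolding c_def .
qed

lemma (in group) subgroup_centralizer:
  assumes "s \<in> carrier G"
  shows "subgroup {x \<in> carrier G. x \<otimes> s = s \<otimes> x} G"
proof (unfold_locales, safe)
  fix x y assume "x \<in> carrier G" "y \<in> carrier G" "x \<otimes> s = s \<otimes> x" "y \<otimes> s = s \<otimes> y"
  with assms show "x \<otimes> y \<otimes> s = s \<otimes> (x \<otimes> y)" by (metis m_assoc)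
next
  fix x assume "x \<in> carrier G" "x \<otimes> s = s \<otimes> x"
  with assms show "inv x \<otimes> s = s \<otimes> inv x" by (metis inv_closed inv_solve_left inv_solve_right m_assoc m_closed)
qed (use assms in auto)

lemma (in group) comm_group_generate:
  assumes S: "S \<subseteq> carrier G" and comm: "\<And>s t. s \<in> S \<Longrightarrow> t \<in> S \<Longrightarrow> s \<otimes> t = t \<otimes> s"
  shows "comm_group (G\<lparr>carrier := generate G S\<rparr>)"
proof -
  note sub = generate_is_subgroup[OF S]
  have gen: "generate G S \<subseteq> {x \<in> carrier G. x \<otimes> s = s \<otimes> x}"
    if "s \<in> carrier G" "\<And>t. t \<in> S \<Longrightarrow> t \<otimes> s = s \<otimes> t" for s
    using that S by (intro generate_subgroup_incl subgroup_centralizer) auto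
  have "x \<otimes> s = s \<otimes> x" if "s \<in> S" "x \<in> generate G S" for s x
    using gen[of s] that S comm by auto
  then have "x \<otimes> y = y \<otimes> x" if "x \<in> generate G S" "y \<in> generate G S" for x y
    using gen[of y] that subgroup.mem_carrier[OF sub] by fastforce
  then show ?thesis
    using subgroup_imp_group[OF sub] by (intro group.group_comm_groupI) auto
qed

text \<open>
  Two elements of the same piece \<open>X i\<close> lie in the same right coset, so every coset is that of the
  representative \<open>p i\<close> chosen for some piece.
\<close>

lemma (in group) card_rcosets_le:
  assumes A: "subgroup A G" and I: "finite I" and cover: "carrier G \<subseteq> (\<Union>i\<in>I. X i)"
    and diff: "\<And>i x y. \<lbrakk>i \<in> I; x \<in> carrier G; y \<in> carrier G; x \<in> X i; y \<in> X i\<rbrakk> \<Longrightarrow> x \<otimes> inv y \<in> A"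
  shows "card (rcosets A) \<le> card I"
proof -
  define p where "p i = (SOME y. y \<in> carrier G \<and> y \<in> X i)" for i
  have "rcosets A \<subseteq> (\<lambda>i. A #> p i) ` I"
  proof
    fix R assume "R \<in> rcosets A"
    then obtain x where x: "x \<in> carrier G" "R = A #> x"
      by (auto simp: RCOSETS_def)
    then obtain i where i: "i \<in> I" "x \<in> X i" using cover by blast
    then have p: "p i \<in> carrier G" "p i \<in> X i"
      unfolding p_def using someI_ex[of "\<lambda>y. y \<in> carrier G \<and> y \<in> X i"] x by blast+
    then have "x \<otimes> inv (p i) \<in> A" using diff i x by blast
    then have "x \<in> A #> p i"
      using x p by (metis A subgroup.rcos_module_rev is_group)
    then have "R = A #> p i"
      using x p repr_independence[OF _ p(1) A] by simp
    then show "R \<in> (\<lambda>i. A #> p i) ` I" using i by blast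
  qed
  then show ?thesis
    using surj_card_le[OF I] by blast
qed

section \<open>Groups with an approximately additive chart\<close>

text \<open>
  What the argument needs of a Banach Lie group: a topological group with a chart \<open>\<psi>\<close> at the
  identity in which the balls form a neighbourhood base and the group law is addition up to an
  error bounded by the product of the norms. Values of \<open>\<psi>\<close> outside its domain \<open>D\<close> carry no information,
  hence the explicit restrictions to \<open>D\<close>.
\<close>

locale group_chart = group U for U :: "('u, 'm) monoid_scheme" (structure) +
  fixes T :: "'u topology" and D :: "'u set" and \<psi> :: "'u \<Rightarrow> 'e::real_normed_vector" and r C :: real
  assumes topspace: "topspace T = carrier U"
    and mult_continuous: "continuous_map (prod_topology T T) T (\<lambda>(x, y). x \<otimes> y)"
    and inv_continuous: "continuous_map T T (\<lambda>x. inv x)"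
    and one_dom: "\<one> \<in> D" and chart_one: "\<psi> \<one> = 0" and chart_inj: "inj_on \<psi> D"
    and small_open: "openin T {x \<in> D. norm (\<psi> x) < e}"
    and small_base: "\<lbrakk>openin T P; \<one> \<in> P\<rbrakk> \<Longrightarrow> \<exists>e>0. {x \<in> D. norm (\<psi> x) < e} \<subseteq> P"
    and r_pos: "r > 0" and C_pos: "C > 0"
    and almost_additive: "\<lbrakk>x \<in> D; y \<in> D; norm (\<psi> x) < r; norm (\<psi> y) < r\<rbrakk> \<Longrightarrow>
      x \<otimes> y \<in> D \<and> norm (\<psi> (x \<otimes> y) - \<psi> x - \<psi> y) \<le> C * (norm (\<psi> x) * norm (\<psi> y))"
begin

definition small :: "real \<Rightarrow> 'u set"
  where "small e = {x \<in> D. norm (\<psi> x) < e}"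

text \<open>
  With \<open>x, y\<close> in the ball of this radius, \<open>y x\<close> has norm below \<open>3 * radius \<le> r\<close>, so the estimate still
  applies to it, and \<open>C\<close> times that norm is below \<open>1/2\<close>.
\<close>

definition radius :: real
  where "radius = min (r / 3) (1 / (8 * C))"

lemma radius: "radius > 0" "3 * radius \<le> r" "8 * (C * radius) \<le> 1"
proof -
  have "C * radius \<le> C * (1 / (8 * C))"
    unfolding radius_def using C_pos by (intro mult_left_mono) auto
  then show "8 * (C * radius) \<le> 1" using C_pos by simp
qed (use r_pos C_pos in \<open>auto simp: radius_def\<close>)

lemma small_subset_carrier: "small e \<subseteq> carrier U"
  using small_open openin_subset topspace unfolding small_def by metis

lemma chart_norm_pos:
  assumes "x \<in> D" "x \<noteq> \<one>"
  shows "norm (\<psi> x) > 0"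
  using assms chart_inj one_dom chart_one by (metis inj_onD zero_less_norm_iff)

lemma norm_chart_square:
  assumes "x \<in> small radius"
  shows "norm (\<psi> (x \<otimes> x)) \<ge> 3 / 2 * norm (\<psi> x)"
proof -
  have x: "x \<in> D" "norm (\<psi> x) < radius" using assms by (auto simp: small_def)
  have "norm (\<psi> (x \<otimes> x) - \<psi> x - \<psi> x) \<le> C * norm (\<psi> x) * norm (\<psi> x)"
    using almost_additive[of x x] x radius by (auto simp: mult_ac)
  also have "\<dots> \<le> 1 / 2 * norm (\<psi> x)"
  proof (rule mult_right_mono)
    have "C * norm (\<psi> x) \<le> C * radius"
      using x C_pos by simp
    then show "C * norm (\<psi> x) \<le> 1 / 2" using radius by simp
  qed simp
  finally have "norm (\<psi> (x \<otimes> x) - (\<psi> x + \<psi> x)) \<le> 1 / 2 * norm (\<psi> x)"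
    by (simp add: algebra_simps)
  moreover have "norm (\<psi> x + \<psi> x) = 2 * norm (\<psi> x)"
    by (simp flip: scaleR_2)
  ultimately show ?thesis
    using norm_triangle_ineq2[of "\<psi> x + \<psi> x" "\<psi> (x \<otimes> x)"] by (simp add: norm_minus_commute)
qed

text \<open>
  There are no small subgroups: along \<open>x, x\<^sup>2, x\<^sup>4, \<dots>\<close> the norm grows geometrically, so it leaves the
  ball unless it is \<open>0\<close> from the start.
\<close>

lemma no_small_powers:
  assumes xc: "x \<in> carrier U" and small: "\<And>m :: nat. x [^] m \<in> small radius"
  shows "x = \<one>"
proof (rule ccontr)
  assume "x \<noteq> \<one>"
  have x: "x \<in> small radius"
    using small[of 1] xc by (metis nat_pow_Suc One_nat_def nat_pow_0 l_one)
  have grow: "(3 / 2) ^ n * norm (\<psi> x) \<le> norm (\<psi> (x [^] ((2::nat) ^ n)))" for n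
  proof (induction n)
    case 0
    then show ?case using xc by simp
  next
    case (Suc n)
    have "x [^] ((2::nat) ^ Suc n) = x [^] ((2::nat) ^ n) \<otimes> x [^] ((2::nat) ^ n)"
      using xc by (simp add: nat_pow_mult mult_2)
    then show ?case
      using Suc.IH norm_chart_square[OF small[of "2 ^ n"]] by simp
  qed
  have pos: "norm (\<psi> x) > 0"
    using \<open>x \<noteq> \<one>\<close> x chart_norm_pos by (auto simp: small_def)
  obtain n where "radius / norm (\<psi> x) < (3 / 2) ^ n"
    using real_arch_pow[of "3 / 2"] by auto
  then have "radius < (3 / 2) ^ n * norm (\<psi> x)"
    using pos by (simp add: field_simps)
  moreover have "norm (\<psi> (x [^] ((2::nat) ^ n))) < radius"
    using small[of "2 ^ n"] by (simp add: small_def)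
  ultimately show False using grow[of n] by linarith
qed

text \<open>
  Write \<open>c = [x, y]\<close> and \<open>w = y x\<close>, so that \<open>c w = x y\<close>. Up to quadratic errors \<open>\<psi>(x y)\<close> and \<open>\<psi> w\<close> both
  equal \<open>\<psi> x + \<psi> y\<close>, while \<open>\<psi>(c w)\<close> equals \<open>\<psi> c + \<psi> w\<close>. Subtracting gives
  \<open>\<parallel>\<psi> c\<parallel> \<le> 2 C \<parallel>\<psi> x\<parallel> \<parallel>\<psi> y\<parallel> + C \<parallel>\<psi> c\<parallel> \<parallel>\<psi> w\<parallel>\<close>, and the last summand is at most \<open>\<parallel>\<psi> c\<parallel> / 2\<close>. Working
  with \<open>c w = x y\<close> avoids any estimate for inverses.
\<close>

lemma commutator_contracts:
  assumes x: "x \<in> small radius" and y: "y \<in> small radius"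
    and c: "commutator x y \<in> small radius"
  shows "norm (\<psi> (commutator x y)) \<le> 1 / 2 * norm (\<psi> y)"
proof -
  define c where "c = commutator x y"
  define w where "w = y \<otimes> x"
  have xyc: "x \<in> carrier U" "y \<in> carrier U"
    using x y small_subset_carrier by auto
  have D: "x \<in> D" "y \<in> D" "c \<in> D"
    and n: "norm (\<psi> x) < radius" "norm (\<psi> y) < radius" "norm (\<psi> c) < radius"
    using assms by (auto simp: small_def c_def)
  have r: "norm (\<psi> x) < r" "norm (\<psi> y) < r" "norm (\<psi> c) < r"
    using n radius by auto
  define q where "q = C * (norm (\<psi> x) * norm (\<psi> y))"
  have Cx: "8 * (C * norm (\<psi> x)) \<le> 1"
    using n(1) C_pos radius(3) mult_left_mono[of "norm (\<psi> x)" radius C] by linarith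
  have q: "8 * q \<le> norm (\<psi> y)"
    using mult_right_mono[OF Cx, of "norm (\<psi> y)"] by (simp add: q_def mult_ac)
  have w: "w \<in> D" "norm (\<psi> w - \<psi> y - \<psi> x) \<le> q"
    using almost_additive[OF D(2,1) r(2,1)] by (auto simp: w_def q_def mult_ac)
  have z: "norm (\<psi> (x \<otimes> y) - \<psi> x - \<psi> y) \<le> q"
    using almost_additive[OF D(1,2) r(1,2)] by (auto simp: q_def)
  have "norm (\<psi> w) \<le> norm (\<psi> w - \<psi> y - \<psi> x) + norm (\<psi> y) + norm (\<psi> x)"
    by norm
  then have nw: "norm (\<psi> w) < 3 * radius"
    using w q n norm_ge_zero[of "\<psi> y"] by linarith
  have "c \<otimes> w = x \<otimes> y"
    using xyc commutator_mult by (simp add: c_def w_def)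
  then have e: "norm (\<psi> (x \<otimes> y) - \<psi> c - \<psi> w) \<le> C * (norm (\<psi> c) * norm (\<psi> w))"
    using almost_additive[of c w] D w nw r radius by auto
  have "C * norm (\<psi> w) \<le> C * (3 * radius)"
    using nw C_pos by simp
  then have "C * norm (\<psi> w) \<le> 1 / 2" using radius(3) by simp
  then have "C * (norm (\<psi> c) * norm (\<psi> w)) \<le> 1 / 2 * norm (\<psi> c)"
    using mult_right_mono[of "C * norm (\<psi> w)" "1 / 2" "norm (\<psi> c)"] by (simp add: mult_ac)
  moreover have "norm (\<psi> c) \<le> norm (\<psi> (x \<otimes> y) - \<psi> c - \<psi> w) +
      norm (\<psi> (x \<otimes> y) - \<psi> x - \<psi> y) + norm (\<psi> w - \<psi> y - \<psi> x)"
    by norm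
  ultimately have "norm (\<psi> c) \<le> 4 * q"
    using e z w by linarith
  then show ?thesis using q by (simp add: c_def)
qed

text \<open>
  The hypothesis \<open>stable\<close> has \<open>x\<close> range over all of \<open>F\<close>, not only over its small elements: it is
  applied to the powers of \<open>x\<close>, which need not be small, and confines the powers of the commutator
  to a ball without nontrivial subgroups.
\<close>

lemma near_elements_commute:
  assumes F: "subgroup F U" "finite F" and e: "e \<le> radius"
    and stable: "\<And>x y. \<lbrakk>x \<in> F; y \<in> small e\<rbrakk> \<Longrightarrow> commutator x y \<in> small radius"
    and x: "x \<in> F \<inter> small e" and y: "y \<in> F \<inter> small e"
  shows "x \<otimes> y = y \<otimes> x"
proof (rule ccontr)
  assume "x \<otimes> y \<noteq> y \<otimes> x"
  let ?B = "{y \<in> F \<inter> small e. x \<otimes> y \<noteq> y \<otimes> x}"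
  have "finite ?B" "?B \<noteq> {}"
    using F y \<open>x \<otimes> y \<noteq> y \<otimes> x\<close> by auto
  then obtain z where z: "z \<in> ?B" and min: "\<And>z'. z' \<in> ?B \<Longrightarrow> norm (\<psi> z) \<le> norm (\<psi> z')"
    using ex_is_arg_min_if_finite[of ?B "\<lambda>z. norm (\<psi> z)"] unfolding is_arg_min_linorder by blast
  define c where "c = commutator x z"
  have sub: "small e \<subseteq> small radius" using e by (auto simp: small_def)
  have carr: "x \<in> carrier U" "z \<in> carrier U"
    using x z F subgroup.mem_carrier by auto
  have cF: "c \<in> F"
    unfolding c_def using F x z by (auto intro: subgroup.m_closed subgroup.m_inv_closed)
  have c: "c \<in> small radius"
    unfolding c_def using stable x z by auto
  have half: "norm (\<psi> c) \<le> 1 / 2 * norm (\<psi> z)"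
    unfolding c_def using x z sub c c_def by (intro commutator_contracts) auto
  have "z \<noteq> \<one>" using z carr by auto
  then have "norm (\<psi> z) > 0"
    using z by (intro chart_norm_pos) (auto simp: small_def)
  with half have less: "norm (\<psi> c) < norm (\<psi> z)" by linarith
  then have "c \<in> small e"
    using z c by (auto simp: small_def)
  moreover have "c \<notin> ?B" using min less by fastforce
  ultimately have comm: "x \<otimes> c = c \<otimes> x" using cF by blast
  have "c [^] m \<in> small radius" for m :: nat
  proof -
    have "x [^] m \<in> F"
      using F(1) x by (induction m) (auto intro: subgroup.m_closed subgroup.one_closed)
    then have "commutator (x [^] m) z \<in> small radius" using stable z by blast
    then show ?thesis
      using commutator_pow_left[OF carr] comm unfolding c_def by simp
  qed
  then have "c = \<one>"
    using c small_subset_carrier by (intro no_small_powers) auto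
  then show False
    using z carr commutator_eq_one_iff unfolding c_def by blast
qed

lemma continuous_map_mult:
  assumes "continuous_map Z T f" "continuous_map Z T g"
  shows "continuous_map Z T (\<lambda>z. f z \<otimes> g z)"
  using continuous_map_compose[OF continuous_map_pairedI[OF assms] mult_continuous]
  by (simp add: o_def)

lemma continuous_map_inverse:
  assumes "continuous_map Z T f"
  shows "continuous_map Z T (\<lambda>z. inv (f z))"
  using continuous_map_compose[OF assms inv_continuous] by (simp add: o_def)

text \<open>
  This is how compactness of \<open>G\<close> enters: a condition that is open in \<open>(x, y)\<close> and holds for \<open>x \<in> G\<close> and
  \<open>y = 1\<close> persists uniformly near \<open>G \<times> {1}\<close>.
\<close>

lemma tube:
  assumes G: "compactin T G" and h: "continuous_map (prod_topology T T) T (\<lambda>(x, y). h x y)"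
    and one: "\<And>x. x \<in> G \<Longrightarrow> h x \<one> \<in> P" and P: "openin T P"
  obtains V e where "openin T V" "G \<subseteq> V" "e > 0"
    "\<And>x y. \<lbrakk>x \<in> V; y \<in> small e\<rbrakk> \<Longrightarrow> h x y \<in> P"
proof -
  let ?W = "{z \<in> topspace (prod_topology T T). (\<lambda>(x, y). h x y) z \<in> P}"
  have "openin (prod_topology T T) ?W"
    using h P by (rule openin_continuous_map_preimage)
  moreover have "G \<times> {\<one>} \<subseteq> ?W"
    using one compactin_subset_topspace[OF G] topspace by auto
  ultimately obtain V Q where VQ: "openin T V" "openin T Q" "G \<subseteq> V" "\<one> \<in> Q" "V \<times> Q \<subseteq> ?W"
    using tube_lemma_left[OF _ G, of T ?W \<one>] topspace by auto
  then obtain e where "e > 0" "small e \<subseteq> Q"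
    using small_base unfolding small_def by blast
  with VQ show ?thesis using that[of V e] by fastforce
qed

text \<open>
  The balls are chosen backwards. Commutators of \<open>V\<close> with \<open>small e\<close> must stay in \<open>small radius\<close>,
  conjugates of \<open>small d\<close> by \<open>V\<close> in \<open>small e\<close>, and quotients of elements of \<open>Q\<close> in \<open>small d\<close>. Right translates
  of \<open>Q\<close> are used because \<open>(q g) (q' g)\<inverse> = q q'\<inverse>\<close>, so the quotient of two points in one translate is small
  without conjugating by \<open>g\<close>.
\<close>

theorem finite_subgroups_near_compact_virtually_abelian:
  assumes G: "subgroup G U" "compactin T G"
  obtains N V where "N > 0" "openin T V" "G \<subseteq> V"
    "\<And>F. \<lbrakk>subgroup F U; finite F; F \<subseteq> V\<rbrakk> \<Longrightarrow>
      \<exists>A. A \<lhd> U\<lparr>carrier := F\<rparr> \<and> comm_group (U\<lparr>carrier := A\<rparr>) \<and>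
          card (rcosets\<^bsub>U\<lparr>carrier := F\<rparr>\<^esub> A) \<le> N"
proof -
  note cont = continuous_map_mult continuous_map_inverse continuous_map_fst continuous_map_snd
  have GU: "G \<subseteq> carrier U" using G(1) subgroup.subset by blast
  have one_small: "\<one> \<in> small e" if "e > 0" for e
    using that one_dom chart_one by (simp add: small_def)
  have openin_small: "openin T (small e)" for e
    using small_open by (simp add: small_def)
  have "continuous_map (prod_topology T T) T (\<lambda>(x, y). commutator x y)"
    unfolding case_prod_unfold by (intro cont)
  then obtain V1 e1 where V1: "openin T V1" "G \<subseteq> V1" and "e1 > 0"
    and comm: "\<And>x y. \<lbrakk>x \<in> V1; y \<in> small e1\<rbrakk> \<Longrightarrow> commutator x y \<in> small radius"
    using GU one_small radius(1)
    by (elim tube[OF G(2), where P = "small radius"]) (auto simp: openin_small subset_iff)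
  define e where "e = min e1 radius"
  have e: "e > 0" "e \<le> radius" "small e \<subseteq> small e1"
    using \<open>e1 > 0\<close> radius by (auto simp: e_def small_def)
  have "continuous_map (prod_topology T T) T (\<lambda>(x, y). x \<otimes> y \<otimes> inv x)"
    unfolding case_prod_unfold by (intro cont)
  then obtain V2 d where V2: "openin T V2" "G \<subseteq> V2" and d: "d > 0"
    and conj: "\<And>x y. \<lbrakk>x \<in> V2; y \<in> small d\<rbrakk> \<Longrightarrow> x \<otimes> y \<otimes> inv x \<in> small e"
    using GU one_small e(1)
    by (elim tube[OF G(2), where P = "small e"]) (auto simp: openin_small subset_iff)
  have one_compact: "compactin T {\<one>}" using topspace by simp
  have "continuous_map (prod_topology T T) T (\<lambda>(x, y). x \<otimes> inv y)"
    unfolding case_prod_unfold by (intro cont)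
  then obtain Q1 q where Q1: "openin T Q1" "{\<one>} \<subseteq> Q1" and q: "q > 0"
    and quot: "\<And>x y. \<lbrakk>x \<in> Q1; y \<in> small q\<rbrakk> \<Longrightarrow> x \<otimes> inv y \<in> small d"
    using one_small d
    by (elim tube[OF one_compact, where P = "small d"]) (auto simp: openin_small)
  define Q where "Q = Q1 \<inter> small q"
  have Q: "openin T Q" "\<one> \<in> Q"
    using Q1 one_small q openin_small by (auto simp: Q_def)
  define X where "X g = {x \<in> topspace T. x \<otimes> inv g \<in> Q}" for g
  have X: "openin T (X g)" if "g \<in> G" for g
  proof -
    have "continuous_map T T (\<lambda>x. x \<otimes> inv g)"
      using that GU topspace by (intro continuous_map_mult) auto
    then show ?thesis
      unfolding X_def using Q(1) by (rule openin_continuous_map_preimage)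
  qed
  have "G \<subseteq> (\<Union>g\<in>G. X g)"
  proof
    fix g assume "g \<in> G"
    then have "g \<in> X g" using GU Q(2) topspace by (auto simp: X_def)
    with \<open>g \<in> G\<close> show "g \<in> (\<Union>g\<in>G. X g)" by blast
  qed
  then obtain \<F> where "finite \<F>" "\<F> \<subseteq> X ` G" "G \<subseteq> \<Union>\<F>"
    using G(2)[unfolded compactin_def, THEN conjunct2, rule_format, of "X ` G"] X by auto
  then obtain I where I: "I \<subseteq> G" "finite I" "G \<subseteq> (\<Union>g\<in>I. X g)"
    using finite_subset_image[of \<F> X G] by auto
  define V where "V = V1 \<inter> V2 \<inter> (\<Union>g\<in>I. X g)"
  show ?thesis
  proof (rule that[of "Suc (card I)" V])
    show "openin T V"
      unfolding V_def using V1 V2 X I(1) by (intro openin_Int openin_Union) auto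
    show "G \<subseteq> V" using V1 V2 I by (auto simp: V_def)
  next
    fix F assume F: "subgroup F U" "finite F" "F \<subseteq> V"
    let ?K = "U\<lparr>carrier := F\<rparr>"
    interpret K: group ?K using F(1) by (rule subgroup_imp_group)
    have inv_K: "inv\<^bsub>?K\<^esub> x = inv x" if "x \<in> F" for x
      using m_inv_consistent[OF F(1) that] .
    have FU: "x \<in> carrier U" if "x \<in> F" for x
      using subgroup.mem_carrier[OF F(1) that] .
    \<comment> \<open>Asking this of all conjugates makes \<open>S\<close> invariant under \<open>F\<close>, hence the subgroup it generates normal.\<close>
    define S where "S = {s \<in> F. \<forall>g\<in>F. g \<otimes> s \<otimes> inv g \<in> small e}"
    have S_small: "s \<in> F \<inter> small e" if "s \<in> S" for s
    proof -
      have "\<one> \<otimes> s \<otimes> inv \<one> \<in> small e"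
        using that subgroup.one_closed[OF F(1)] unfolding S_def by blast
      then show ?thesis using that FU by (auto simp: S_def)
    qed
    have near: "x \<in> S" if "x \<in> F" "x \<in> small d" for x
      using that F(3) conj by (auto simp: S_def V_def)
    have comm_S: "s \<otimes> t = t \<otimes> s" if "s \<in> S" "t \<in> S" for s t
    proof (rule near_elements_commute[OF F(1,2) e(2)])
      show "commutator x y \<in> small radius" if "x \<in> F" "y \<in> small e" for x y
        using that F(3) comm e(3) by (auto simp: V_def)
    qed (use that S_small in auto)
    have conj_S: "g \<otimes> s \<otimes> inv g \<in> S" if s: "s \<in> S" and g: "g \<in> F" for s g
    proof -
      have "s \<in> F" using s by (simp add: S_def)
      have "h \<otimes> (g \<otimes> s \<otimes> inv g) \<otimes> inv h \<in> small e" if h: "h \<in> F" for h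
      proof -
        have "h \<otimes> g \<otimes> s \<otimes> inv (h \<otimes> g) \<in> small e"
          using s g h subgroup.m_closed[OF F(1)] by (auto simp: S_def)
        then show ?thesis
          using \<open>s \<in> F\<close> g h FU by (simp add: inv_mult_group m_assoc)
      qed
      then show ?thesis
        using \<open>s \<in> F\<close> g F(1) by (auto simp: S_def intro: subgroup.m_closed subgroup.m_inv_closed)
    qed
    define A where "A = generate ?K S"
    have SF: "S \<subseteq> carrier ?K" by (auto simp: S_def)
    have "A \<lhd> ?K"
      unfolding A_def using SF conj_S by (intro K.normal_generateI) (auto simp: inv_K)
    moreover have "comm_group (U\<lparr>carrier := A\<rparr>)"
      using K.comm_group_generate[OF SF] comm_S by (simp add: A_def)
    moreover have "card (rcosets\<^bsub>?K\<^esub> A) \<le> card I"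
    proof (rule K.card_rcosets_le[where X = X])
      show "subgroup A ?K" unfolding A_def by (rule K.generate_is_subgroup[OF SF])
      show "finite I" by (rule I)
      show "carrier ?K \<subseteq> (\<Union>g\<in>I. X g)" using F(3) by (auto simp: V_def)
    next
      fix g x y
      assume g: "g \<in> I" and "x \<in> carrier ?K" "y \<in> carrier ?K" and xy: "x \<in> X g" "y \<in> X g"
      then have F': "x \<in> F" "y \<in> F" by auto
      have gU: "g \<in> carrier U" using g I GU by blast
      have "(x \<otimes> inv g) \<otimes> inv (y \<otimes> inv g) \<in> small d"
        using xy quot by (auto simp: X_def Q_def)
      also have "(x \<otimes> inv g) \<otimes> inv (y \<otimes> inv g) = x \<otimes> inv y"
        using F'[THEN FU] gU by (simp add: inv_mult_group m_assoc inv_solve_left')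
      finally have "x \<otimes> inv y \<in> S"
        using F' F(1) by (intro near) (auto intro: subgroup.m_closed subgroup.m_inv_closed)
      then show "x \<otimes>\<^bsub>?K\<^esub> inv\<^bsub>?K\<^esub> y \<in> A"
        using F' by (simp add: A_def inv_K generate.incl)
    qed
    ultimately show "\<exists>A. A \<lhd> ?K \<and> comm_group (U\<lparr>carrier := A\<rparr>) \<and>
        card (rcosets\<^bsub>?K\<^esub> A) \<le> Suc (card I)"
      by (meson le_SucI)
  qed simp
qed

end

section \<open>Banach Lie groups\<close>

text \<open>
  In the coordinates of a chart \<open>\<phi>\<close> with \<open>\<phi> 1 = p\<close>, multiplication is an analytic map \<open>f\<close> near \<open>(p, p)\<close>
  with \<open>f (u, p) = u\<close> and \<open>f (p, v) = v\<close>. Hence its second difference in the directions \<open>(\<psi> x, 0)\<close> and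
  \<open>(0, \<psi> y)\<close> is exactly \<open>\<psi>(x y) - \<psi> x - \<psi> y\<close>.
\<close>

lemma (in banach_lie_group) group_chart_exists:
  obtains D and \<psi> :: "'u \<Rightarrow> 'e" and r C where "group_chart U T D \<psi> r C"
proof -
  have "\<one> \<in> (\<Union>(D, \<phi>)\<in>\<A>. D)"
    using atlas topspace_eq by (simp add: analytic_atlas_def)
  then obtain D \<phi> where chart: "(D, \<phi>) \<in> \<A>" and one_D: "\<one> \<in> D" by auto
  then have is_chart: "is_chart T (D, \<phi>)"
    using atlas unfolding analytic_atlas_def by blast
  then have D_open: "openin T D" and im_open: "open (\<phi> ` D)"
    and homeo: "homeomorphic_map (subtopology T D) (top_of_set (\<phi> ` D)) \<phi>"
    by (auto simp: is_chart_def)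
  have D_sub: "D \<subseteq> carrier U" using openin_subset[OF D_open] topspace_eq by simp
  then have top_D: "topspace (subtopology T D) = D" using topspace_eq by auto
  have inj: "inj_on \<phi> D"
    using homeomorphic_imp_injective_map[OF homeo] top_D by simp
  define p where "p = \<phi> \<one>"
  define \<psi> where "\<psi> x = \<phi> x - p" for x
  define f where "f = \<phi> \<circ> (\<lambda>(x, y). x \<otimes> y) \<circ> inv_into (D \<times> D) (map_prod \<phi> \<phi>)"
  define S where "S = map_prod \<phi> \<phi> ` {z \<in> D \<times> D. (case z of (x, y) \<Rightarrow> x \<otimes> y) \<in> D}"
  have "(D \<times> D, map_prod \<phi> \<phi>) \<in> prod_atlas \<A> \<A>"
    using chart by (auto simp: prod_atlas_def)
  then have analytic: "real_analytic_on f S"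
    using mult_analytic chart unfolding analytic_map_def f_def S_def by blast
  have f_eq: "f (\<phi> x, \<phi> y) = \<phi> (x \<otimes> y)" if "x \<in> D" "y \<in> D" for x y
    using inv_into_f_f[OF map_prod_inj_on[OF inj inj], of "(x, y)"] that by (simp add: f_def)
  have "(p, p) \<in> S"
    using one_D by (auto simp: S_def p_def intro!: image_eqI[of _ _ "(\<one>, \<one>)"])
  then obtain r C where r: "r > 0" and C: "C > 0" and ball: "ball (p, p) r \<subseteq> S"
    and diff: "\<And>a b. \<lbrakk>norm a < r; norm b < r\<rbrakk> \<Longrightarrow>
      norm (f ((p, p) + (a + b)) - f ((p, p) + a) - f ((p, p) + b) + f (p, p)) \<le> C * (norm a * norm b)"
    using real_analytic_second_difference[OF analytic] by blast
  \<comment> \<open>Half the radius, so that \<open>(\<psi> x, \<psi> y)\<close> has norm below \<open>r\<close>; this ensures \<open>x y \<in> D\<close>.\<close>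
  have "group_chart U T D \<psi> (r / 2) C"
  proof
    show "topspace T = carrier U" by (rule topspace_eq)
    show "continuous_map (prod_topology T T) T (\<lambda>(x, y). x \<otimes> y)"
      using mult_analytic by (simp add: analytic_map_def)
    show "continuous_map T T (\<lambda>x. inv x)"
      using inv_analytic by (simp add: analytic_map_def)
    show "\<one> \<in> D" by (rule one_D)
    show "\<psi> \<one> = 0" by (simp add: \<psi>_def p_def)
    show "inj_on \<psi> D" using inj by (simp add: \<psi>_def inj_on_def)
    show "r / 2 > 0" "C > 0" using r C by auto
  next
    fix e :: real
    have "openin (top_of_set (\<phi> ` D)) (\<phi> ` D \<inter> ball p e)"
      by (simp add: openin_open_Int)
    then have "openin (subtopology T D) {x \<in> D. \<phi> x \<in> \<phi> ` D \<inter> ball p e}"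
      by (rule openin_continuous_map_preimage
          [OF homeomorphic_imp_continuous_map[OF homeo], unfolded top_D])
    then have "openin T {x \<in> D. \<phi> x \<in> \<phi> ` D \<inter> ball p e}"
      using D_open openin_trans_full by blast
    moreover have "{x \<in> D. \<phi> x \<in> \<phi> ` D \<inter> ball p e} = {x \<in> D. norm (\<psi> x) < e}"
      by (auto simp: \<psi>_def dist_norm norm_minus_commute)
    ultimately show "openin T {x \<in> D. norm (\<psi> x) < e}" by simp
  next
    fix P assume P: "openin T P" "\<one> \<in> P"
    have "openin (subtopology T D) (P \<inter> D)"
      using P(1) openin_subtopology by blast
    then have "openin (top_of_set (\<phi> ` D)) (\<phi> ` (P \<inter> D))"
      using homeomorphic_imp_open_map[OF homeo] by (simp add: open_map_def)
    then have "open (\<phi> ` (P \<inter> D))"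
      using im_open openin_open_trans by blast
    moreover have "p \<in> \<phi> ` (P \<inter> D)" using P one_D by (auto simp: p_def)
    ultimately obtain e where e: "e > 0" "ball p e \<subseteq> \<phi> ` (P \<inter> D)"
      by (meson openE)
    have "x \<in> P" if "x \<in> D" "norm (\<psi> x) < e" for x
    proof -
      have "\<phi> x \<in> \<phi> ` (P \<inter> D)"
        using that e by (auto simp: \<psi>_def dist_norm norm_minus_commute subset_iff)
      then show ?thesis using inj that(1) by (auto dest: inj_onD)
    qed
    with e show "\<exists>e>0. {x \<in> D. norm (\<psi> x) < e} \<subseteq> P" by blast
  next
    fix x y assume D: "x \<in> D" "y \<in> D" and n: "norm (\<psi> x) < r / 2" "norm (\<psi> y) < r / 2"
    have "norm (\<psi> x, \<psi> y) < r"
      using norm_Pair_le[of "\<psi> x" "\<psi> y"] n by simp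
    moreover have "(\<phi> x, \<phi> y) = (p, p) + (\<psi> x, \<psi> y)" by (simp add: \<psi>_def)
    moreover have "q + h \<in> ball q r" if "norm h < r" for q h :: "'e \<times> 'e"
      using that by (simp add: dist_norm)
    ultimately have "(\<phi> x, \<phi> y) \<in> S"
      using ball by (metis subsetD)
    then obtain x' y' where "x' \<in> D" "y' \<in> D" "x' \<otimes> y' \<in> D" "\<phi> x' = \<phi> x" "\<phi> y' = \<phi> y"
      by (auto simp: S_def)
    then have xy: "x \<otimes> y \<in> D" using inj D by (metis inj_onD)
    have n': "norm (\<psi> x, 0::'e) < r" "norm (0::'e, \<psi> y) < r"
      using n r by (auto simp: norm_Pair)
    have "(p, p) + ((\<psi> x, 0) + (0, \<psi> y)) = (\<phi> x, \<phi> y)" "(p, p) + (\<psi> x, 0) = (\<phi> x, \<phi> \<one>)"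
      "(p, p) + (0, \<psi> y) = (\<phi> \<one>, \<phi> y)" "(p, p) = (\<phi> \<one>, \<phi> \<one>)"
      by (auto simp: \<psi>_def p_def)
    then have "norm (\<phi> (x \<otimes> y) - \<phi> x - \<phi> y + p) \<le> C * (norm (\<psi> x) * norm (\<psi> y))"
      using diff[OF n'] D one_D D_sub f_eq by (auto simp: norm_Pair p_def subset_iff)
    then show "x \<otimes> y \<in> D \<and> norm (\<psi> (x \<otimes> y) - \<psi> x - \<psi> y) \<le> C * (norm (\<psi> x) * norm (\<psi> y))"
      using xy by (simp add: \<psi>_def algebra_simps)
  qed
  then show ?thesis by (rule that)
qed

theorem theorem2p19:
  fixes U :: "('u, 'm) monoid_scheme" (structure)
    and T :: "'u topology" and \<A> :: "('u, 'e::banach) chart set"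
    and G :: "'u set"
  assumes "banach_lie_group U T \<A>"
    and "subgroup G U" and "compactin T G"
  shows "\<exists>N::nat. N > 0 \<and>
    (\<exists>V\<^sub>0 \<subseteq> topspace T. (\<exists>W. openin T W \<and> G \<subseteq> W \<and> W \<subseteq> V\<^sub>0) \<and>
      (\<forall>F. subgroup F U \<and> finite F \<and> F \<subseteq> V\<^sub>0 \<longrightarrow>
        (\<exists>A. A \<lhd> U\<lparr>carrier := F\<rparr> \<and> comm_group (U\<lparr>carrier := A\<rparr>) \<and>
             card (rcosets\<^bsub>U\<lparr>carrier := F\<rparr>\<^esub> A) \<le> N)))"
proof -
  obtain D and \<psi> :: "'u \<Rightarrow> 'e" and r C where "group_chart U T D \<psi> r C"
    using banach_lie_group.group_chart_exists[OF assms(1)] .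
  then obtain N V where "N > 0" and V: "openin T V" "G \<subseteq> V"
    and "\<And>F. \<lbrakk>subgroup F U; finite F; F \<subseteq> V\<rbrakk> \<Longrightarrow>
      \<exists>A. A \<lhd> U\<lparr>carrier := F\<rparr> \<and> comm_group (U\<lparr>carrier := A\<rparr>) \<and>
          card (rcosets\<^bsub>U\<lparr>carrier := F\<rparr>\<^esub> A) \<le> N"
    using group_chart.finite_subgroups_near_compact_virtually_abelian[OF _ assms(2,3)] by metis
  moreover have "V \<subseteq> topspace T" using V(1) by (rule openin_subset)
  ultimately show ?thesis by (meson order_refl)
qed

end
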